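(* There is an absolute constant $C>0$ such that for every $d\ge1$, every $p\in[1,\infty]$ and every $\epsilon\in(0,1)$ there exists a one-sided, non-adaptive $(\epsilon,\ell_p)$-tester for real symmetric $d\times d$ matrices that makes at most $C\,\frac{1}{\epsilon^2}d^{2-2/p}$ vector-matrix-vector queries (with $1/p=0$ for $p=\infty$).
   Context: For a real symmetric matrix $A$, $\|A\|_p$ denotes the Schatten-$p$ norm (the $\ell_p$ norm of the vector of singular values; $\|A\|_\infty$ is the operator norm), and $\lambda_{\min}(A)$ its smallest eigenvalue. PSD means positive semidefinite. A randomized algorithm has access to an unknown real symmetric $d\times d$ matrix $A$ only through vector-matrix-vector queries: it chooses $v,w\in\mathbb{R}^d$ and receives $v^TAw$. It is non-adaptive if all query vectors are chosen (possibly at random) before any answer is received. Computation is otherwise free; the number of queries is counted in the worst case over inputs and coins. For $p\in[1,\infty]$ and $\epsilon\in(0,1)$, an $(\epsilon,\ell_p)$-tester is such an algorithm that outputs True with probability at least $2/3$ if $A$ is PSD, and outputs False with probability at least $2/3$ if $A\neq 0$ and $\lambda_{\min}(A)\le-\epsilon\|A\|_p$. The tester is one-sided if on every PSD input it outputs True for every outcome of its random coins. *)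

theory Defs
  imports "HOL-Probability.Probability" "Jordan_Normal_Form.Spectral_Radius"
begin

unbundle no vec_syntax and no inner_syntax
hide_type (open) Finite_Cartesian_Product.vec

definition symmetric_mat :: "nat \<Rightarrow> real mat \<Rightarrow> bool" where
  "symmetric_mat d A \<longleftrightarrow> A \<in> carrier_mat d d \<and> transpose_mat A = A"

definition psd :: "nat \<Rightarrow> real mat \<Rightarrow> bool" where
  "psd d A \<longleftrightarrow> symmetric_mat d A \<and> (\<forall>x \<in> carrier_vec d. 0 \<le> x \<bullet> (A *\<^sub>v x))"

definition lambda_min :: "real mat \<Rightarrow> real" where
  "lambda_min A = Min (spectrum A)"

definition singular_values :: "real mat \<Rightarrow> real multiset" where
  "singular_values A = image_mset sqrt (proots (char_poly (transpose_mat A * A)))"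

text \<open>Intended for \<open>1 \<le> p \<le> \<infinity>\<close> and matrices with at least one column.\<close>

definition schatten_norm :: "ereal \<Rightarrow> real mat \<Rightarrow> real" where
  "schatten_norm p A =
    (if p = \<infinity> then Max (set_mset (singular_values A))
     else (\<Sum>s \<in># singular_values A. s powr real_of_ereal p) powr (1 / real_of_ereal p))"

text \<open>
  The random coins are a sequence of reals with an arbitrary joint distribution on the product
  Borel sigma-algebra. The algorithm is non-adaptive because the number of queries and the query
  vectors are functions of the coins only; the matrix enters through the answers alone. Only the
  queries with index below \<open>num_queries\<close> are made.
\<close>

type_synonym coins = "nat \<Rightarrow> real"

record nonadaptive_alg =
  coin_dist :: "coins measure"
  num_queries :: "coins \<Rightarrow> nat"
  left_query :: "nat \<Rightarrow> coins \<Rightarrow> real vec"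
  right_query :: "nat \<Rightarrow> coins \<Rightarrow> real vec"
  decide :: "coins \<Rightarrow> (nat \<Rightarrow> real) \<Rightarrow> bool"

definition answers :: "nonadaptive_alg \<Rightarrow> real mat \<Rightarrow> coins \<Rightarrow> (nat \<Rightarrow> real)" where
  "answers T A \<omega> =
    (\<lambda>i. if i < num_queries T \<omega> then left_query T i \<omega> \<bullet> (A *\<^sub>v right_query T i \<omega>) else 0)"

definition run :: "nonadaptive_alg \<Rightarrow> real mat \<Rightarrow> coins \<Rightarrow> bool" where
  "run T A \<omega> = decide T \<omega> (answers T A \<omega>)"

text \<open>
  The decision is required to be jointly measurable in coins and answers. Asking only that
  each individual matrix is accepted on a measurable event would admit pathological algorithms
  (for instance under the continuum hypothesis).
\<close>

definition valid_alg :: "nat \<Rightarrow> nonadaptive_alg \<Rightarrow> bool" where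
  "valid_alg d T \<longleftrightarrow>
    prob_space (coin_dist T) \<and>
    sets (coin_dist T) = sets (\<Pi>\<^sub>M i\<in>UNIV. (borel :: real measure)) \<and>
    num_queries T \<in> measurable (coin_dist T) (count_space UNIV) \<and>
    (\<forall>i \<omega>. left_query T i \<omega> \<in> carrier_vec d \<and> right_query T i \<omega> \<in> carrier_vec d) \<and>
    (\<forall>i. \<forall>j < d. (\<lambda>\<omega>. vec_index (left_query T i \<omega>) j) \<in> borel_measurable (coin_dist T) \<and>
                  (\<lambda>\<omega>. vec_index (right_query T i \<omega>) j) \<in> borel_measurable (coin_dist T)) \<and>
    (\<lambda>(\<omega>, a). decide T \<omega> a) \<in>
      measurable (coin_dist T \<Otimes>\<^sub>M (\<Pi>\<^sub>M i\<in>UNIV. (borel :: real measure))) (count_space UNIV)"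

lemma run_measurable:
  assumes T: "valid_alg d T" and A: "A \<in> carrier_mat d d"
  shows "run T A \<in> measurable (coin_dist T) (count_space UNIV)"
proof -
  let ?M = "coin_dist T"
  have car: "left_query T i \<omega> \<in> carrier_vec d" "right_query T i \<omega> \<in> carrier_vec d" for i \<omega>
    using T by (auto simp: valid_alg_def)
  have [measurable]: "num_queries T \<in> measurable ?M (count_space UNIV)"
    using T by (simp add: valid_alg_def)
  have coord: "(\<lambda>\<omega>. vec_index (left_query T i \<omega>) j) \<in> borel_measurable ?M"
    "(\<lambda>\<omega>. vec_index (right_query T i \<omega>) j) \<in> borel_measurable ?M" if "j < d" for i j
    using T that by (auto simp: valid_alg_def)
  have q: "left_query T i \<omega> \<bullet> (A *\<^sub>v right_query T i \<omega>) =
      (\<Sum>j<d. vec_index (left_query T i \<omega>) j * (\<Sum>k<d. A $$ (j, k) * vec_index (right_query T i \<omega>) k))"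
    for i \<omega>
    using car(1)[of i \<omega>] car(2)[of i \<omega>] A
    by (auto simp: scalar_prod_def lessThan_atLeast0 intro!: sum.cong)
  have m [measurable]: "(\<lambda>\<omega>. left_query T i \<omega> \<bullet> (A *\<^sub>v right_query T i \<omega>)) \<in> borel_measurable ?M" for i
    unfolding q by (intro borel_measurable_sum borel_measurable_times borel_measurable_const coord) auto
  have "(\<lambda>\<omega>. answers T A \<omega> i) \<in> borel_measurable ?M" for i
    unfolding answers_def by measurable
  hence "answers T A \<in> measurable ?M (\<Pi>\<^sub>M i\<in>UNIV. (borel :: real measure))"
    by (intro measurable_PiM_single') auto
  hence pair: "(\<lambda>\<omega>. (\<omega>, answers T A \<omega>)) \<in> measurable ?M (?M \<Otimes>\<^sub>M (\<Pi>\<^sub>M i\<in>UNIV. (borel :: real measure)))"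
    by (intro measurable_Pair measurable_ident_sets refl)
  have dec: "(\<lambda>(\<omega>, a). decide T \<omega> a) \<in>
      measurable (?M \<Otimes>\<^sub>M (\<Pi>\<^sub>M i\<in>UNIV. (borel :: real measure))) (count_space UNIV)"
    using T unfolding valid_alg_def by blast
  show ?thesis
    using measurable_compose[OF pair dec] by (simp only: run_def[abs_def] prod.case)
qed

definition prob_output :: "nonadaptive_alg \<Rightarrow> real mat \<Rightarrow> bool \<Rightarrow> real" where
  "prob_output T A b = measure (coin_dist T) {\<omega> \<in> space (coin_dist T). run T A \<omega> = b}"

definition psd_tester :: "nat \<Rightarrow> real \<Rightarrow> ereal \<Rightarrow> nonadaptive_alg \<Rightarrow> bool" where
  "psd_tester d \<epsilon> p T \<longleftrightarrow>
    valid_alg d T \<and>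
    (\<forall>A. symmetric_mat d A \<longrightarrow>
      (psd d A \<longrightarrow> prob_output T A True \<ge> 2 / 3) \<and>
      (A \<noteq> 0\<^sub>m d d \<and> lambda_min A \<le> - \<epsilon> * schatten_norm p A \<longrightarrow> prob_output T A False \<ge> 2 / 3))"

definition one_sided :: "nat \<Rightarrow> nonadaptive_alg \<Rightarrow> bool" where
  "one_sided d T \<longleftrightarrow> (\<forall>A. psd d A \<longrightarrow> (\<forall>\<omega> \<in> space (coin_dist T). run T A \<omega>))"

definition makes_at_most :: "nonadaptive_alg \<Rightarrow> real \<Rightarrow> bool" where
  "makes_at_most T q \<longleftrightarrow> (\<forall>\<omega> \<in> space (coin_dist T). real (num_queries T \<omega>) \<le> q)"

end

theory Submission
  imports Defs
begin


text \<open>Let G be a random d x k sign matrix with k about 48 d^(1-1/p) / \<epsilon>. The tester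
  queries all k^2 entries of G^T A G and accepts iff this form is nonnegative. Since x^T (G^T A G) x
  = (Gx)^T A (Gx), a PSD matrix is never rejected, whatever the coins are
  (\<open>one_sided_sketch_tester\<close>).

  For a far matrix take orthonormal eigenvectors v_m with eigenvalues f_m
  (\<open>symmetric_mat_eigen_expansion\<close>), and let f_i be the smallest. Test the sketch at x
  = G^T v_i, that is, test A at y = G G^T v_i. The value is the sum of f_m T_m^2, where T_m = <v_m,
  y> = v_m^T G G^T v_i. Each T_m has mean k if m = i and mean 0 otherwise, and variance at most 2k
  (\<open>rademacher_bilinear_variance\<close>). So the negative term is of order f_i k^2, while the
  others together are of order k times M, the sum of all |f_m|.

  The power mean inequality gives M \<le> d^(1-1/p) ||A||_p (\<open>sum_le_schatten_norm\<close>),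
  hence f_i \<le> - \<epsilon> M / d^(1-1/p), and for the chosen k the negative term wins. One
  Markov bound on a weighted sum of squared deviations gives failure probability at most 1/3;
  \<open>eigenvalue_sum_neg\<close> is the deterministic part of this argument.\<close>

section \<open>The real spectral theorem\<close>

lemma symmetric_matD:
  assumes "symmetric_mat n A"
  shows "A \<in> carrier_mat n n" "transpose_mat A = A"
    "\<And>i j. i < n \<Longrightarrow> j < n \<Longrightarrow> A $$ (i, j) = A $$ (j, i)"
proof -
  show A: "A \<in> carrier_mat n n" "transpose_mat A = A"
    using assms by (auto simp: symmetric_mat_def)
  show "A $$ (i, j) = A $$ (j, i)" if "i < n" "j < n" for i j
    using A(1) that index_transpose_mat(1)[of j A i] by (simp add: A(2))
qed

text \<open>Over the complex numbers an eigenvector z exists. The Hermitian form z^* A z equals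
  \<mu> times the squared length of z and, by symmetry of A, is its own conjugate; so \<mu> is real
  and a root of the real characteristic polynomial.\<close>

lemma symmetric_mat_eigenvalue_exists:
  assumes A: "symmetric_mat n A" and n: "n > 0"
  shows "\<exists>e. eigenvalue A e"
proof -
  note AC = symmetric_matD(1)[OF A]
  let ?B = "map_mat complex_of_real A"
  have B: "?B \<in> carrier_mat n n" using AC by auto
  obtain \<mu> where mu: "eigenvalue ?B \<mu>"
    using spectrum_non_empty[OF B n] by (auto simp: spectrum_def)
  then obtain z where z: "z \<in> carrier_vec n" "z \<noteq> 0\<^sub>v n" "?B *\<^sub>v z = \<mu> \<cdot>\<^sub>v z"
    using B unfolding eigenvalue_def eigenvector_def by auto
  define N where "N = (\<Sum>a<n. cnj (z $ a) * z $ a)"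
  have row: "(\<Sum>b<n. A $$ (a, b) * z $ b) = \<mu> * z $ a" if "a < n" for a
  proof -
    have "(?B *\<^sub>v z) $ a = (\<Sum>b<n. A $$ (a, b) * z $ b)"
      using that AC z(1) by (auto simp: scalar_prod_def lessThan_atLeast0 intro!: sum.cong)
    thus ?thesis using that z(1,3) by simp
  qed
  have form: "(\<Sum>a<n. \<Sum>b<n. A $$ (a, b) * cnj (z $ a) * z $ b) = \<mu> * N"
    unfolding N_def sum_distrib_left
  proof (rule sum.cong[OF refl])
    fix a assume "a \<in> {..<n}"
    hence "\<mu> * (cnj (z $ a) * z $ a) = cnj (z $ a) * (\<Sum>b<n. A $$ (a, b) * z $ b)"
      by (simp add: row)
    thus "(\<Sum>b<n. A $$ (a, b) * cnj (z $ a) * z $ b) = \<mu> * (cnj (z $ a) * z $ a)"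
      by (simp add: sum_distrib_left mult_ac)
  qed
  have "cnj (\<mu> * N) = (\<Sum>a<n. \<Sum>b<n. A $$ (a, b) * z $ a * cnj (z $ b))"
    by (simp flip: form)
  also have "\<dots> = (\<Sum>b<n. \<Sum>a<n. A $$ (a, b) * z $ a * cnj (z $ b))"
    by (rule sum.swap)
  also have "\<dots> = \<mu> * N"
    unfolding form[symmetric] by (intro sum.cong refl) (simp add: symmetric_matD(3)[OF A] mult_ac)
  finally have 1: "cnj (\<mu> * N) = \<mu> * N" .
  have N: "N = of_real (\<Sum>a<n. (cmod (z $ a))\<^sup>2)"
    by (simp add: N_def complex_norm_square mult.commute del: of_real_power)
  obtain i where i: "i < n" "z $ i \<noteq> 0"
    using z(1,2) by (metis carrier_vecD eq_vecI index_zero_vec(1,2))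
  have "(\<Sum>a<n. (cmod (z $ a))\<^sup>2) > 0"
    by (rule sum_pos2[of _ i]) (use i in auto)
  hence "N \<noteq> 0" "cnj N = N" by (simp_all only: N of_real_eq_0_iff complex_cnj_complex_of_real)
  hence "cnj \<mu> = \<mu>" using 1 by simp
  hence mu_re: "\<mu> = of_real (Re \<mu>)" by (simp add: complex_eq_iff)
  have "poly (char_poly ?B) \<mu> = 0"
    using mu eigenvalue_root_char_poly[OF B] by simp
  also have "char_poly ?B = map_poly of_real (char_poly A)"
    by (rule of_real_hom.char_poly_hom[OF AC])
  finally have "poly (char_poly A) (Re \<mu>) = 0"
    by (subst (asm) mu_re) (simp add: of_real_hom.poly_map_poly)
  thus ?thesis using eigenvalue_root_char_poly[OF AC] by auto
qed

text \<open>W is the reflection along h = w - e_0, which exchanges e_0 and the unit vector w. Being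
  a symmetric involution, it is an orthogonal change of basis that is its own inverse.\<close>

lemma householder:
  fixes w :: "nat \<Rightarrow> real"
  assumes w: "(\<Sum>a<Suc m. (w a)\<^sup>2) = 1"
  shows "\<exists>W. symmetric_mat (Suc m) W \<and> W * W = 1\<^sub>m (Suc m) \<and> (\<forall>a<Suc m. W $$ (a, 0) = w a)"
proof -
  note [simp del] = sum.lessThan_Suc
  define h where "h = (\<lambda>a. w a - (if a = 0 then 1 else 0))"
  define s where "s = (\<Sum>a<Suc m. (h a)\<^sup>2)"
  \<comment> \<open>If \<open>s = 0\<close> then \<open>2 / s = 0\<close> and \<open>W\<close> is the identity, as it should be for \<open>w = e\<^sub>0\<close>.\<close>
  define W where "W = mat (Suc m) (Suc m) (\<lambda>(a, b). (if a = b then 1 else 0) - 2 / s * h a * h b)"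
  have WC: "W \<in> carrier_mat (Suc m) (Suc m)" by (simp add: W_def)
  have sym: "symmetric_mat (Suc m) W"
    unfolding symmetric_mat_def by (auto simp: W_def intro!: eq_matI)
  \<comment> \<open>This is |w - e_0|^2 for a unit vector w. It makes \<open>h 0\<close> equal to
    \<open>- s / 2\<close>, which is why the first column of W is e_0 + h = w.\<close>
  have "s = (\<Sum>a<Suc m. (w a)\<^sup>2 - (if a = 0 then 2 * w 0 - 1 else 0))"
    unfolding s_def h_def by (intro sum.cong refl) (auto simp: power2_eq_square algebra_simps)
  hence s: "s = 2 - 2 * w 0"
    unfolding sum_subtractf w by simp
  have h0: "h 0 = - s / 2" by (simp add: h_def s field_simps)
  have "W * W = 1\<^sub>m (Suc m)"
  proof (rule eq_matI)
    fix a b assume ab: "a < dim_row (1\<^sub>m (Suc m) :: real mat)" "b < dim_col (1\<^sub>m (Suc m) :: real mat)"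
    have "(W * W) $$ (a, b) = (\<Sum>c<Suc m. W $$ (a, c) * W $$ (c, b))"
      using ab WC by (simp add: scalar_prod_def lessThan_atLeast0)
    also have "\<dots> = (\<Sum>c<Suc m. (if c = a then (if a = b then 1 else 0) - 2 / s * h a * h b else 0)
        - (if c = b then 2 / s * h a * h b else 0) + 4 / s\<^sup>2 * h a * h b * (h c)\<^sup>2)"
      using ab by (intro sum.cong refl) (auto simp: W_def power2_eq_square algebra_simps)
    also have "\<dots> = (if a = b then 1 else 0) - 4 / s * h a * h b + 4 / s\<^sup>2 * h a * h b * s"
    proof -
      have "(\<Sum>c<Suc m. 4 / s\<^sup>2 * h a * h b * (h c)\<^sup>2) = 4 / s\<^sup>2 * h a * h b * s"
        by (simp only: sum_distrib_left[symmetric] s_def[symmetric])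
      thus ?thesis using ab by (simp add: sum.distrib sum_subtractf)
    qed
    \<comment> \<open>The last two terms cancel; for \<open>s = 0\<close> both vanish because
      division by zero gives zero.\<close>
    also have "\<dots> = (if a = b then 1 else 0)"
      by (simp add: power2_eq_square)
    finally show "(W * W) $$ (a, b) = 1\<^sub>m (Suc m) $$ (a, b)" using ab by simp
  qed (use WC in auto)
  moreover have "W $$ (a, 0) = w a" if "a < Suc m" for a
  proof (cases "s = 0")
    case True
    hence "h a = 0" using that by (simp add: s_def sum_nonneg_eq_0_iff del: sum.lessThan_Suc)
    thus ?thesis using that True by (auto simp: W_def h_def split: if_splits)
  next
    case False
    hence "W $$ (a, 0) = (if a = 0 then 1 else 0) + h a"
      using that by (simp add: W_def h0)
    thus ?thesis by (simp add: h_def)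
  qed
  ultimately show ?thesis using sym by blast
qed

lemma mult_mat_regroup:
  assumes "A \<in> carrier_mat n n" "B \<in> carrier_mat n n" "C \<in> carrier_mat n n"
    "D \<in> carrier_mat n n" "E \<in> carrier_mat n n"
  shows "A * (B * C * D) * E = (A * B) * C * (D * E)"
  using assms by (simp add: assoc_mult_mat[of _ n n _ n _ n] mult_carrier_mat[of _ n n _ n])

lemma mult_block_diag_mat:
  assumes "A \<in> carrier_mat n n" "B \<in> carrier_mat n n" "C \<in> carrier_mat m m" "D \<in> carrier_mat m m"
  shows "four_block_mat A (0\<^sub>m n m) (0\<^sub>m m n) C * four_block_mat B (0\<^sub>m n m) (0\<^sub>m m n) D =
    four_block_mat (A * B) (0\<^sub>m n m) (0\<^sub>m m n) (C * D)"
  using assms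
  by (subst mult_four_block_mat[OF assms(1) _ _ assms(3,2) _ _ assms(4)])
    (auto simp: mult_carrier_mat[of _ n n _ n] mult_carrier_mat[of _ m m _ m])

text \<open>Induction by deflation: a reflection W moves a unit eigenvector to the first coordinate,
  conjugation by W splits off the eigenvalue as a 1 x 1 block, and the induction hypothesis
  diagonalises the remaining symmetric block.\<close>

theorem real_spectral_theorem:
  assumes "symmetric_mat n A"
  shows "\<exists>P f. P \<in> carrier_mat n n \<and> transpose_mat P * P = 1\<^sub>m n \<and>
    A = P * mat_diag n f * transpose_mat P"
  using assms
proof (induction n arbitrary: A)
  case 0
  have "A = 1\<^sub>m 0 * mat_diag 0 (\<lambda>_. 0) * transpose_mat (1\<^sub>m 0)"
    using symmetric_matD(1)[OF 0] by (intro eq_matI) auto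
  thus ?case by (intro exI[of _ "1\<^sub>m 0"] exI[of _ "\<lambda>_. 0"]) simp
next
  case (Suc m)
  note [simp del] = sum.lessThan_Suc
  let ?n = "Suc m"
  note AC [simp] = symmetric_matD(1)[OF Suc.prems]
  obtain e v where v: "v \<in> carrier_vec ?n" "v \<noteq> 0\<^sub>v ?n" "A *\<^sub>v v = e \<cdot>\<^sub>v v"
    using symmetric_mat_eigenvalue_exists[OF Suc.prems] AC
    unfolding eigenvalue_def eigenvector_def by auto
  define N where "N = (\<Sum>a<?n. (v $ a)\<^sup>2)"
  obtain i where i: "i < ?n" "v $ i \<noteq> 0"
    using v(1,2) by (metis carrier_vecD eq_vecI index_zero_vec(1,2))
  have N: "N > 0" unfolding N_def by (rule sum_pos2[of _ i]) (use i in auto)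
  define w where "w = (\<lambda>a. v $ a / sqrt N)"
  have "(\<Sum>a<?n. (w a)\<^sup>2) = 1"
    using N by (simp add: w_def power_divide N_def flip: sum_divide_distrib)
  then obtain W where Ws: "symmetric_mat ?n W" and WW: "W * W = 1\<^sub>m ?n"
    and W0: "\<And>a. a < ?n \<Longrightarrow> W $$ (a, 0) = w a"
    using householder by blast
  note WC [simp] = symmetric_matD(1)[OF Ws]
  note Wt = symmetric_matD(2)[OF Ws]
  define B where "B = W * A * W"
  have BC [simp]: "B \<in> carrier_mat ?n ?n"
    by (auto simp: B_def intro!: mult_carrier_mat[of _ _ ?n])
  have Bs: "symmetric_mat ?n B"
    unfolding symmetric_mat_def B_def using BC[unfolded B_def]
    by (simp add: transpose_mult[of _ ?n ?n _ ?n] Wt symmetric_matD(2)[OF Suc.prems]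
        assoc_mult_mat[of _ ?n ?n _ ?n _ ?n] mult_carrier_mat[of _ ?n ?n _ ?n])
  \<comment> \<open>The first column of W is the normalised eigenvector, so B = W A W has first
    column e times the first unit vector.\<close>
  have AW0: "A *\<^sub>v col W 0 = e \<cdot>\<^sub>v col W 0"
  proof -
    have "col W 0 = (1 / sqrt N) \<cdot>\<^sub>v v"
      using v(1) carrier_matD[OF WC] by (intro eq_vecI) (auto simp: W0 w_def)
    thus ?thesis using v
      by (simp add: mult_mat_vec[OF AC] smult_smult_assoc mult.commute)
  qed
  have "col B 0 = W *\<^sub>v (A *\<^sub>v col W 0)"
    unfolding B_def
    by (subst assoc_mult_mat[of _ ?n ?n _ ?n _ ?n])
      (auto simp: col_mult2[of _ ?n ?n _ ?n] mult_carrier_mat[of _ ?n ?n _ ?n])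
  also have "\<dots> = e \<cdot>\<^sub>v col (W * W) 0"
    using WC by (simp add: AW0 mult_mat_vec[OF WC col_carrier_vec[OF _ WC]] col_mult2[of _ ?n ?n _ ?n])
  finally have col0: "col B 0 = e \<cdot>\<^sub>v unit_vec ?n 0" by (simp add: WW)
  have B0: "B $$ (a, 0) = (if a = 0 then e else 0)" if "a < ?n" for a
    using that arg_cong[OF col0, of "\<lambda>x. x $ a"] carrier_matD[OF BC] by simp
  define C where "C = mat m m (\<lambda>(a, b). B $$ (Suc a, Suc b))"
  have CC [simp]: "C \<in> carrier_mat m m" by (simp add: C_def)
  have "symmetric_mat m C"
    unfolding symmetric_mat_def
    by (auto simp: C_def intro!: eq_matI symmetric_matD(3)[OF Bs])
  from Suc.IH[OF this] obtain P f where P [simp]: "P \<in> carrier_mat m m"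
    and PP: "transpose_mat P * P = 1\<^sub>m m" and C: "C = P * mat_diag m f * transpose_mat P"
    by blast
  define E where "E = mat 1 1 (\<lambda>_. e)"
  have EC [simp]: "E \<in> carrier_mat 1 1" by (simp add: E_def)
  define g where "g = case_nat e f"
  define Q where "Q = four_block_mat (1\<^sub>m 1) (0\<^sub>m 1 m) (0\<^sub>m m 1) P"
  have QC [simp]: "Q \<in> carrier_mat ?n ?n"
    using four_block_carrier_mat[of "1\<^sub>m 1" 1 1 P m m] by (simp add: Q_def)
  have Qt: "transpose_mat Q = four_block_mat (1\<^sub>m 1) (0\<^sub>m 1 m) (0\<^sub>m m 1) (transpose_mat P)"
    unfolding Q_def by (subst transpose_four_block_mat[of _ 1 1 _ m _ m]) auto
  \<comment> \<open>The first column is known; symmetry of B gives the first row.\<close>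
  have B: "B = four_block_mat E (0\<^sub>m 1 m) (0\<^sub>m m 1) C"
  proof (rule eq_matI)
    fix a b assume "a < dim_row (four_block_mat E (0\<^sub>m 1 m) (0\<^sub>m m 1) C)"
      "b < dim_col (four_block_mat E (0\<^sub>m 1 m) (0\<^sub>m m 1) C)"
    hence ab: "a < ?n" "b < ?n" by (auto simp: E_def C_def)
    show "B $$ (a, b) = four_block_mat E (0\<^sub>m 1 m) (0\<^sub>m m 1) C $$ (a, b)"
      using ab B0[of a] B0[of b] symmetric_matD(3)[OF Bs, of a b]
      by (auto simp: E_def C_def)
  qed (use carrier_matD[OF BC] in \<open>auto simp: E_def C_def\<close>)
  have D: "mat_diag ?n g = four_block_mat E (0\<^sub>m 1 m) (0\<^sub>m m 1) (mat_diag m f)"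
    by (rule eq_matI) (auto simp: E_def mat_diag_def g_def split: nat.splits)
  have PC: "P * mat_diag m f \<in> carrier_mat m m"
    by (rule mult_carrier_mat[of _ m m _ m]) auto
  have QD: "Q * mat_diag ?n g = four_block_mat E (0\<^sub>m 1 m) (0\<^sub>m m 1) (P * mat_diag m f)"
    unfolding Q_def D
    by (subst mult_block_diag_mat) (auto simp: left_mult_one_mat[OF EC] simp flip: One_nat_def)
  have QDQ: "B = Q * mat_diag ?n g * transpose_mat Q"
    unfolding QD Qt B C using PC
    by (subst mult_block_diag_mat) (auto simp: right_mult_one_mat[OF EC] simp flip: One_nat_def)
  have QQ: "transpose_mat Q * Q = 1\<^sub>m ?n"
    unfolding Qt unfolding Q_def by (subst mult_block_diag_mat) (auto simp: PP)
  have WQC [simp]: "W * Q \<in> carrier_mat ?n ?n" by (rule mult_carrier_mat[of _ ?n ?n _ ?n]) auto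
  have "transpose_mat (W * Q) * (W * Q) = transpose_mat Q * ((W * W) * Q)"
    by (simp add: transpose_mult[of _ ?n ?n _ ?n] Wt assoc_mult_mat[of _ ?n ?n _ ?n _ ?n]
         mult_carrier_mat[of _ ?n ?n _ ?n])
  also have "\<dots> = 1\<^sub>m ?n" by (simp add: WW QQ left_mult_one_mat[of _ ?n ?n])
  finally have 1: "transpose_mat (W * Q) * (W * Q) = 1\<^sub>m ?n" .
  have "A = (W * W) * A * (W * W)"
    by (simp add: WW left_mult_one_mat[OF AC] right_mult_one_mat[OF AC])
  also have "\<dots> = W * B * W"
    unfolding B_def by (rule mult_mat_regroup[symmetric, where n = ?n]) auto
  also have "\<dots> = (W * Q) * mat_diag ?n g * (transpose_mat Q * W)"
    unfolding QDQ by (rule mult_mat_regroup[where n = ?n]) auto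
  also have "transpose_mat Q * W = transpose_mat (W * Q)"
    by (simp add: transpose_mult[of _ ?n ?n _ ?n] Wt)
  finally show ?case using 1 WQC by blast
qed


section \<open>Eigenvalues and singular values in coordinates\<close>

text \<open>Similar matrices share the characteristic polynomial, and that of a diagonal matrix is a
  product of linear factors. The multiset of roots keeps multiplicities, which Schatten norms
  count.\<close>

lemma proots_char_poly_similar_diag:
  fixes A :: "real mat"
  assumes "similar_mat A (mat_diag n f)"
  shows "proots (char_poly A) = image_mset f (mset_set {..<n})"
    and "char_poly A \<noteq> 0"
proof -
  have diag: "diag_mat (mat_diag n f) = map f [0..<n]"
    by (auto simp: diag_mat_def mat_diag_def)
  have cp: "char_poly A = (\<Prod>a\<leftarrow>map f [0..<n]. [:- a, 1:])"
    unfolding char_poly_similar[OF assms] diag[symmetric]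
    by (rule char_poly_upper_triangular[OF mat_diag_dim]) (auto simp: mat_diag_def)
  have ne: "0 \<notin> set (map (\<lambda>a. [:- a, 1:]) (map f [0..<n]))" by auto
  show "char_poly A \<noteq> 0"
    using ne by (simp only: cp prod_list_zero_iff) simp
  have "proots (char_poly A) = (\<Sum>a\<leftarrow>map f [0..<n]. {#a#})"
    using proots_prod_list[OF ne] by (simp add: cp o_def)
  also have "\<dots> = mset (map f [0..<n])"
    by (induction n) auto
  also have "\<dots> = image_mset f (mset_set {..<n})"
    by (simp add: lessThan_atLeast0)
  finally show "proots (char_poly A) = image_mset f (mset_set {..<n})" .
qed

text \<open>The vectors v are the columns of the diagonalising P. The same P diagonalises A^T A with
  entries \<open>(f i)\<^sup>2\<close>, whose square roots are the absolute eigenvalues.\<close>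

theorem symmetric_mat_eigen_expansion:
  assumes A: "symmetric_mat n A"
  shows "\<exists>f v. (\<forall>i<n. \<forall>j<n. (\<Sum>a<n. v i a * v j a) = of_bool (i = j)) \<and>
    (\<forall>a<n. \<forall>b<n. A $$ (a, b) = (\<Sum>m<n. f m * v m a * v m b)) \<and>
    spectrum A = f ` {..<n} \<and>
    singular_values A = image_mset (\<lambda>i. \<bar>f i\<bar>) (mset_set {..<n})"
proof -
  obtain P f where P [simp]: "P \<in> carrier_mat n n" and PtP: "transpose_mat P * P = 1\<^sub>m n"
    and APD: "A = P * mat_diag n f * transpose_mat P"
    using real_spectral_theorem[OF A] by blast
  have PPt: "P * transpose_mat P = 1\<^sub>m n"
    by (rule mat_mult_left_right_inverse[OF _ P PtP]) simp
  note AC = symmetric_matD(1)[OF A]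
  have sim: "similar_mat A (mat_diag n f)"
    using AC by (intro similar_matI[where n = n and P = P and Q = "transpose_mat P"]) (auto simp: PPt PtP APD)
  have PD [simp]: "P * mat_diag n g \<in> carrier_mat n n" for g
    by (rule mult_carrier_mat[of _ n n]) auto
  define v where "v = (\<lambda>i a. P $$ (a, i))"
  have 1: "(\<Sum>a<n. v i a * v j a) = of_bool (i = j)" if "i < n" "j < n" for i j
  proof -
    have "(\<Sum>a<n. v i a * v j a) = (transpose_mat P * P) $$ (i, j)"
      using that carrier_matD[OF P] by (simp add: v_def scalar_prod_def lessThan_atLeast0)
    thus ?thesis using that by (simp add: PtP)
  qed
  have 2: "A $$ (a, b) = (\<Sum>m<n. f m * v m a * v m b)" if "a < n" "b < n" for a b
    unfolding APD mat_diag_mult_right[OF P]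
    using that carrier_matD[OF P]
    by (auto simp: scalar_prod_def v_def lessThan_atLeast0 intro!: sum.cong)
  have "spectrum A = set_mset (proots (char_poly A))"
    using proots_char_poly_similar_diag(2)[OF sim] by (simp add: spectrum_root_char_poly[OF AC])
  hence 3: "spectrum A = f ` {..<n}"
    by (simp add: proots_char_poly_similar_diag(1)[OF sim])
  have "transpose_mat A * A = A * A" by (simp add: symmetric_matD(2)[OF A])
  also have "\<dots> = (P * mat_diag n f) * (transpose_mat P * (P * mat_diag n f * transpose_mat P))"
    unfolding APD by (rule assoc_mult_mat[of _ n n _ n _ n]) (auto intro!: mult_carrier_mat[of _ n n])
  also have "transpose_mat P * (P * mat_diag n f * transpose_mat P) =
      mat_diag n f * transpose_mat P"
    using mult_mat_regroup[of "transpose_mat P" n P "mat_diag n f" "transpose_mat P" "1\<^sub>m n"]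
    by (simp add: PtP right_mult_one_mat[of _ n n] left_mult_one_mat[of _ n n] mult_carrier_mat[of _ n n _ n])
  also have "(P * mat_diag n f) * (mat_diag n f * transpose_mat P) =
      P * (1\<^sub>m n * mat_diag n f * mat_diag n f) * transpose_mat P"
    using mult_mat_regroup[of P n "mat_diag n f" "1\<^sub>m n" "mat_diag n f" "transpose_mat P"]
    by (simp add: right_mult_one_mat[of _ n n] left_mult_one_mat[of _ n n])
  finally have "transpose_mat A * A = P * mat_diag n (\<lambda>i. (f i)\<^sup>2) * transpose_mat P"
    by (simp add: power2_eq_square left_mult_one_mat[of _ n n])
  hence "similar_mat (transpose_mat A * A) (mat_diag n (\<lambda>i. (f i)\<^sup>2))"
    using AC by (intro similar_matI[where n = n and P = P and Q = "transpose_mat P"])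
      (auto simp: PPt PtP mult_carrier_mat[of _ n n _ n])
  hence 4: "singular_values A = image_mset (\<lambda>i. \<bar>f i\<bar>) (mset_set {..<n})"
    unfolding singular_values_def
    by (simp add: proots_char_poly_similar_diag(1) multiset.map_comp o_def)
  from 1 2 3 4 show ?thesis by blast
qed

section \<open>Comparison of Schatten norms\<close>

text \<open>Jensen's inequality for the convex function \<open>x powr p\<close> with equal
  weights.\<close>

lemma powr_mean_ge_mean:
  fixes x :: "'a \<Rightarrow> real"
  assumes I: "finite I" "I \<noteq> {}" and x: "\<And>i. i \<in> I \<Longrightarrow> x i > 0" and p: "p \<ge> 1"
  shows "(\<Sum>i\<in>I. x i) \<le> real (card I) powr (1 - 1 / p) * (\<Sum>i\<in>I. x i powr p) powr (1 / p)"
proof -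
  define c where "c = real (card I)"
  have c: "c > 0" using I by (simp add: c_def card_gt_0_iff)
  have "(\<Sum>i\<in>I. (1 / c) *\<^sub>R x i) powr p \<le> (\<Sum>i\<in>I. (1 / c) * x i powr p)"
    by (rule convex_on_sum[OF I powr_convex[OF p]]) (use c x in \<open>auto simp: c_def\<close>)
  hence le: "((\<Sum>i\<in>I. x i) / c) powr p \<le> (\<Sum>i\<in>I. x i powr p) / c"
    by (simp flip: sum_divide_distrib)
  have pos: "(\<Sum>i\<in>I. x i) > 0" using x I by (intro sum_pos)
  have "(\<Sum>i\<in>I. x i) / c = (((\<Sum>i\<in>I. x i) / c) powr p) powr (1 / p)"
    using pos c p by (simp add: powr_powr)
  also have "\<dots> \<le> ((\<Sum>i\<in>I. x i powr p) / c) powr (1 / p)"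
    by (rule powr_mono2) (use le p in auto)
  also have "\<dots> = (\<Sum>i\<in>I. x i powr p) powr (1 / p) / c powr (1 / p)"
    by (rule powr_divide)
  finally show ?thesis using c
    by (simp add: c_def[symmetric] powr_diff field_simps)
qed

text \<open>Bounds the trace norm by the Schatten-p norm; this is the source of the dimension factor
  in the query count.\<close>

lemma sum_le_schatten_norm:
  assumes n: "n \<ge> 1" and p: "1 \<le> p"
    and sv: "singular_values A = image_mset (\<lambda>i. \<bar>f i\<bar>) (mset_set {..<n})"
  shows "(\<Sum>i<n. \<bar>f i\<bar>) \<le> real n powr (1 - 1 / real_of_ereal p) * schatten_norm p A"
proof (cases p)
  case (real r)
  hence r: "r \<ge> 1" using p by simp
  \<comment> \<open>The library has convexity of \<open>x powr r\<close> only on the positive reals, so zero eigenvalues are left out.\<close>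
  define I where "I = {i. i < n \<and> f i \<noteq> 0}"
  have I: "finite I" "I \<subseteq> {..<n}" by (auto simp: I_def)
  have norm: "schatten_norm p A = (\<Sum>i<n. \<bar>f i\<bar> powr r) powr (1 / r)"
    using real by (simp add: schatten_norm_def sv multiset.map_comp o_def sum_unfold_sum_mset)
  show ?thesis
  proof (cases "I = {}")
    case True
    hence "(\<Sum>i<n. \<bar>f i\<bar>) = 0" by (auto simp: I_def)
    thus ?thesis by (simp add: norm)
  next
    case False
    have "(\<Sum>i<n. \<bar>f i\<bar>) = (\<Sum>i\<in>I. \<bar>f i\<bar>)"
      by (rule sum.mono_neutral_right) (auto simp: I_def)
    also have "\<dots> \<le> real (card I) powr (1 - 1 / r) * (\<Sum>i\<in>I. \<bar>f i\<bar> powr r) powr (1 / r)"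
      by (rule powr_mean_ge_mean[OF I(1) False _ r]) (auto simp: I_def)
    also have "(\<Sum>i\<in>I. \<bar>f i\<bar> powr r) = (\<Sum>i<n. \<bar>f i\<bar> powr r)"
      by (rule sum.mono_neutral_left) (auto simp: I_def)
    also have "real (card I) powr (1 - 1 / r) \<le> real n powr (1 - 1 / r)"
      using card_mono[OF _ I(2)] r by (intro powr_mono2) auto
    finally show ?thesis unfolding norm using real by (simp add: mult_right_mono)
  qed
next
  \<comment> \<open>Here \<open>real_of_ereal p\<close> is 0 and \<open>1 / 0\<close> is 0, so the
    factor is n itself, as it should be for the operator norm.\<close>
  case PInf
  have "\<bar>f i\<bar> \<le> schatten_norm p A" if "i < n" for i
    using PInf that by (auto simp: schatten_norm_def sv intro!: Max_ge)
  hence "(\<Sum>i<n. \<bar>f i\<bar>) \<le> (\<Sum>i<n. schatten_norm p A)" by (intro sum_mono) auto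
  thus ?thesis using PInf n by (simp add: powr_one)
qed (use p in simp)


section \<open>Second moments of random signs\<close>

text \<open>The sample space is the power set of the coordinate set; \<open>S\<close> is the set of negative signs.\<close>

definition rademacher :: "nat set \<Rightarrow> nat \<Rightarrow> real" where
  "rademacher S i = (if i \<in> S then -1 else 1)"

lemma rademacher_square [simp]: "rademacher S i * rademacher S i = 1"
  by (simp add: rademacher_def)

text \<open>Flipping the sign of coordinate r is an involution of the sample space, so a function
  that is odd in that sign has mean zero.\<close>

lemma sum_Pow_flip_eq_0:
  fixes F :: "'a set \<Rightarrow> real"
  assumes "r \<in> A" and F: "\<And>S. F (sym_diff S {r}) = - F S"
  shows "(\<Sum>S\<in>Pow A. F S) = 0"
proof -
  have "(\<Sum>S\<in>Pow A. F S) = (\<Sum>S\<in>Pow A. - F S)"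
    by (rule sum.reindex_bij_witness[where i = "\<lambda>S. sym_diff S {r}" and j = "\<lambda>S. sym_diff S {r}"])
      (use assms in auto)
  thus ?thesis by (simp add: sum_negf)
qed

lemma rademacher_flip:
  "rademacher (sym_diff S {r}) i = (if i = r then - rademacher S i else rademacher S i)"
  by (auto simp: rademacher_def)

text \<open>If the increasing pairs differ, then p or q lies outside the other pair, and flipping
  that sign negates exactly one of the four factors.\<close>

lemma sum_rademacher_pairs:
  assumes "p < q" "q < N" "p' < q'" "q' < N"
  shows "(\<Sum>S\<in>Pow {..<N}. (rademacher S p * rademacher S q) * (rademacher S p' * rademacher S q')) =
    (if p = p' \<and> q = q' then 2 ^ N else 0)"
proof -
  have one: "(rademacher S p * rademacher S q) * (rademacher S p * rademacher S q) = 1" for S p q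
    by (simp add: rademacher_def)
  consider "p = p'" "q = q'" | "p \<noteq> p'" "p \<noteq> q'" | "q \<noteq> p'" "q \<noteq> q'"
    using assms by fastforce
  thus ?thesis
  proof cases
    case 1
    thus ?thesis by (simp only: one) (simp add: card_Pow)
  next
    case 2
    have "(\<Sum>S\<in>Pow {..<N}. (rademacher S p * rademacher S q) * (rademacher S p' * rademacher S q')) = 0"
      by (rule sum_Pow_flip_eq_0[of p]) (use assms 2 in \<open>auto simp: rademacher_flip\<close>)
    thus ?thesis using 2 by simp
  next
    case 3
    have "(\<Sum>S\<in>Pow {..<N}. (rademacher S p * rademacher S q) * (rademacher S p' * rademacher S q')) = 0"
      by (rule sum_Pow_flip_eq_0[of q]) (use assms 3 in \<open>auto simp: rademacher_flip\<close>)
    thus ?thesis using 3 by simp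
  qed
qed

lemma sum_square_orthogonal:
  fixes \<phi> :: "'i \<Rightarrow> 's \<Rightarrow> real"
  assumes I: "finite I"
    and orth: "\<And>i j. i \<in> I \<Longrightarrow> j \<in> I \<Longrightarrow> (\<Sum>s\<in>\<Omega>. \<phi> i s * \<phi> j s) = (if i = j then K else 0)"
  shows "(\<Sum>s\<in>\<Omega>. (\<Sum>i\<in>I. c i * \<phi> i s)\<^sup>2) = K * (\<Sum>i\<in>I. (c i)\<^sup>2)"
proof -
  have "(\<Sum>s\<in>\<Omega>. (\<Sum>i\<in>I. c i * \<phi> i s)\<^sup>2) =
      (\<Sum>s\<in>\<Omega>. \<Sum>i\<in>I. \<Sum>j\<in>I. c i * c j * (\<phi> i s * \<phi> j s))"
    by (simp add: power2_eq_square sum_product mult_ac)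
  also have "\<dots> = (\<Sum>i\<in>I. \<Sum>j\<in>I. c i * c j * (\<Sum>s\<in>\<Omega>. \<phi> i s * \<phi> j s))"
    unfolding sum_distrib_left by (subst sum.swap, rule sum.cong[OF refl], rule sum.swap)
  also have "\<dots> = (\<Sum>i\<in>I. \<Sum>j\<in>I. if i = j then c i * c j * K else 0)"
    by (intro sum.cong refl) (simp add: orth)
  also have "\<dots> = K * (\<Sum>i\<in>I. (c i)\<^sup>2)"
    using I by (simp add: power2_eq_square sum_distrib_left mult_ac)
  finally show ?thesis .
qed

definition pairs_below :: "nat \<Rightarrow> (nat \<times> nat) set" where
  "pairs_below d = {(a, b). a < b \<and> b < d}"

lemma finite_pairs_below [simp]: "finite (pairs_below d)"
  by (rule finite_subset[of _ "{..<d} \<times> {..<d}"]) (auto simp: pairs_below_def)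

lemma sum_square_split_diagonal:
  fixes g :: "nat \<Rightarrow> nat \<Rightarrow> real"
  shows "(\<Sum>a<d. \<Sum>b<d. g a b) = (\<Sum>a<d. g a a) + (\<Sum>(a, b)\<in>pairs_below d. g a b + g b a)"
proof -
  let ?D = "(\<lambda>a. (a, a)) ` {..<d}" and ?U = "pairs_below d"
  let ?L = "prod.swap ` pairs_below d"
  have "{..<d} \<times> {..<d} = ?D \<union> (?U \<union> ?L)"
    by (force simp: pairs_below_def image_iff)
  hence "(\<Sum>a<d. \<Sum>b<d. g a b) = (\<Sum>(a, b)\<in>?D \<union> (?U \<union> ?L). g a b)"
    by (simp add: sum.cartesian_product)
  also have "\<dots> = (\<Sum>(a, b)\<in>?D. g a b) + ((\<Sum>(a, b)\<in>?U. g a b) + (\<Sum>(a, b)\<in>?L. g a b))"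
    by (subst sum.union_disjoint, simp, simp, force simp: pairs_below_def,
        subst sum.union_disjoint) (auto simp: pairs_below_def[symmetric], auto simp: pairs_below_def)
  also have "(\<Sum>(a, b)\<in>?D. g a b) = (\<Sum>a<d. g a a)"
    by (subst sum.reindex) (auto simp: inj_on_def)
  also have "(\<Sum>(a, b)\<in>?L. g a b) = (\<Sum>(a, b)\<in>?U. g b a)"
    by (subst sum.reindex) (auto simp: inj_on_def intro!: sum.cong)
  finally show ?thesis by (simp add: sum.distrib case_prod_unfold)
qed

text \<open>Signs square to 1, so the diagonal terms of T are constant and add up to k <v, w>. What
  remains is a combination of products of two distinct signs in one block; these products are
  orthonormal, so the variance is the sum of the squared coefficients.\<close>

lemma rademacher_bilinear_variance:
  fixes v w :: "nat \<Rightarrow> real" and k :: nat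
  assumes v: "(\<Sum>a<d. (v a)\<^sup>2) = 1" and w: "(\<Sum>a<d. (w a)\<^sup>2) = 1"
  defines "T \<equiv> \<lambda>S. \<Sum>j<k. (\<Sum>a<d. v a * rademacher S (j * d + a)) *
                            (\<Sum>a<d. w a * rademacher S (j * d + a))"
  shows "measure_pmf.expectation (pmf_of_set (Pow {..<k * d}))
    (\<lambda>S. (T S - real k * (\<Sum>a<d. v a * w a))\<^sup>2) \<le> 2 * real k"
proof -
  let ?R = rademacher
  define I where "I = {..<k} \<times> pairs_below d"
  define c where "c = (\<lambda>(j::nat, a, b). v a * w b + v b * w a)"
  define \<phi> where "\<phi> = (\<lambda>(j, a, b) S. ?R S (j * d + a) * ?R S (j * d + b))"
  have "T S - real k * (\<Sum>a<d. v a * w a) = (\<Sum>i\<in>I. c i * \<phi> i S)" for S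
  proof -
    have "T S = (\<Sum>j<k. \<Sum>a<d. \<Sum>b<d. (v a * w b) * (?R S (j * d + a) * ?R S (j * d + b)))"
      unfolding T_def sum_product by (simp add: mult_ac)
    also have "\<dots> = (\<Sum>j<k. (\<Sum>a<d. v a * w a) + (\<Sum>ab\<in>pairs_below d. c (j, ab) * \<phi> (j, ab) S))"
      unfolding sum_square_split_diagonal
      by (intro sum.cong refl arg_cong2[where f = "(+)"])
        (auto simp: c_def \<phi>_def algebra_simps)
    finally show ?thesis
      by (simp add: sum.distrib I_def sum.cartesian_product case_prod_unfold)
  qed
  hence "measure_pmf.expectation (pmf_of_set (Pow {..<k * d}))
      (\<lambda>S. (T S - real k * (\<Sum>a<d. v a * w a))\<^sup>2) =
    (\<Sum>S\<in>Pow {..<k * d}. (\<Sum>i\<in>I. c i * \<phi> i S)\<^sup>2) / 2 ^ (k * d)"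
    by (subst integral_pmf_of_set) (auto simp: card_Pow)
  also have "\<dots> = (\<Sum>i\<in>I. (c i)\<^sup>2)"
  proof (subst sum_square_orthogonal[where K = "2 ^ (k * d)"])
    fix i i' assume "i \<in> I" "i' \<in> I"
    then obtain j a b j' a' b' where i: "i = (j, a, b)" "i' = (j', a', b')" "j < k" "j' < k"
      and ab: "a < b" "b < d" "a' < b'" "b' < d"
      by (auto simp: I_def pairs_below_def)
    have lt: "j * d + b < k * d" if "j < k" "b < d" for j b
    proof -
      have "j * d + b < Suc j * d" using that by simp
      also have "\<dots> \<le> k * d" using that by (intro mult_right_mono) auto
      finally show ?thesis .
    qed
    \<comment> \<open>Division by d recovers the block, so different blocks use disjoint
      signs.\<close>
    have eq: "j * d + a = j' * d + a' \<longleftrightarrow> j = j' \<and> a = a'" if "a < d" "a' < d" for a a'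
    proof
      assume *: "j * d + a = j' * d + a'"
      have "(j * d + a) div d = j" "(j' * d + a') div d = j'" using that by auto
      thus "j = j' \<and> a = a'" using * by auto
    qed auto
    show "(\<Sum>S\<in>Pow {..<k * d}. \<phi> i S * \<phi> i' S) = (if i = i' then 2 ^ (k * d) else 0)"
      using sum_rademacher_pairs[of "j * d + a" "j * d + b" "k * d" "j' * d + a'" "j' * d + b'"]
        ab lt[OF i(3), of b] lt[OF i(4), of b'] eq[of a a'] eq[of b b']
      by (auto simp: i(1,2) \<phi>_def)
  qed (auto simp: I_def)
  also have "\<dots> = real k * (\<Sum>(a, b)\<in>pairs_below d. (v a * w b + v b * w a)\<^sup>2)"
    using sum.cartesian_product[of "\<lambda>_ (a, b). (v a * w b + v b * w a)\<^sup>2" "pairs_below d" "{..<k}"]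
    by (simp add: I_def c_def case_prod_unfold)
  finally have *: "measure_pmf.expectation (pmf_of_set (Pow {..<k * d}))
      (\<lambda>S. (T S - real k * (\<Sum>a<d. v a * w a))\<^sup>2) =
    real k * (\<Sum>(a, b)\<in>pairs_below d. (v a * w b + v b * w a)\<^sup>2)" .
  \<comment> \<open>By (x + y)^2 \<le> 2 x^2 + 2 y^2 the sum over pairs is bounded by off-diagonal
    terms only; adding the nonnegative diagonal completes it to 2 |v|^2 |w|^2.\<close>
  have "(\<Sum>(a, b)\<in>pairs_below d. (v a * w b + v b * w a)\<^sup>2) \<le>
      (\<Sum>(a, b)\<in>pairs_below d. 2 * ((v a)\<^sup>2 * (w b)\<^sup>2) + 2 * ((v b)\<^sup>2 * (w a)\<^sup>2))"
  proof (intro sum_mono, clarify)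
    fix a b
    have "0 \<le> (v a * w b - v b * w a)\<^sup>2" by simp
    thus "(v a * w b + v b * w a)\<^sup>2 \<le> 2 * ((v a)\<^sup>2 * (w b)\<^sup>2) + 2 * ((v b)\<^sup>2 * (w a)\<^sup>2)"
      by (simp add: power2_eq_square algebra_simps)
  qed
  also have "\<dots> \<le> (\<Sum>a<d. \<Sum>b<d. 2 * ((v a)\<^sup>2 * (w b)\<^sup>2))"
    unfolding sum_square_split_diagonal by (simp add: sum_nonneg)
  also have "\<dots> = 2 * ((\<Sum>a<d. (v a)\<^sup>2) * (\<Sum>b<d. (w b)\<^sup>2))"
    by (subst sum_product) (simp add: sum_distrib_left)
  also have "\<dots> = 2" by (simp add: v w)
  finally show ?thesis
    unfolding * by (subst (2) mult.commute) (rule mult_left_mono, auto)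
qed


section \<open>The tester\<close>

text \<open>Column j of the d x k matrix G, stored in the coins column by column.\<close>

definition sketch_column :: "nat \<Rightarrow> nat \<Rightarrow> coins \<Rightarrow> real vec" where
  "sketch_column d j \<omega> = vec d (\<lambda>a. \<omega> (j * d + a))"

text \<open>
  The form is tested on integer vectors only: these are countably many, so the decision is clearly
  measurable, and by density and homogeneity a form that is negative somewhere is negative at one of them.
\<close>

definition sketch_tester :: "nat \<Rightarrow> nat \<Rightarrow> nonadaptive_alg" where
  "sketch_tester d k =
    \<lparr>coin_dist = distr (measure_pmf (pmf_of_set (Pow {..<k * d}))) (\<Pi>\<^sub>M i\<in>UNIV. borel) rademacher,
     num_queries = \<lambda>_. k * k,
     left_query = \<lambda>i \<omega>. sketch_column d (i div k) \<omega>,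
     right_query = \<lambda>i \<omega>. sketch_column d (i mod k) \<omega>,
     decide = \<lambda>\<omega> a. \<forall>z::int list.
       0 \<le> (\<Sum>j<k. \<Sum>l<k. real_of_int (z ! j) * real_of_int (z ! l) * a (j * k + l))\<rparr>"

lemma rademacher_measurable:
  "rademacher \<in> measurable (measure_pmf P) (\<Pi>\<^sub>M i\<in>UNIV. (borel :: real measure))"
  by (simp add: space_PiM)

lemma valid_alg_sketch_tester: "valid_alg d (sketch_tester d k)"
proof -
  let ?M = "\<Pi>\<^sub>M i\<in>UNIV. (borel :: real measure)"
  let ?D = "distr (measure_pmf (pmf_of_set (Pow {..<k * d}))) ?M rademacher"
  have sets: "sets ?D = sets ?M" by simp
  have comp: "(\<lambda>\<omega>. \<omega> i) \<in> borel_measurable ?D" for i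
    unfolding measurable_cong_sets[OF sets refl] by (rule measurable_component_singleton) simp
  have [measurable]: "(\<lambda>x. snd x i) \<in> borel_measurable (?D \<Otimes>\<^sub>M ?M)" for i
    by (rule measurable_compose[OF measurable_snd measurable_component_singleton]) simp
  have "(\<lambda>x. \<forall>z::int list. 0 \<le> (\<Sum>j<k. \<Sum>l<k.
      real_of_int (z ! j) * real_of_int (z ! l) * snd x (j * k + l)))
      \<in> measurable (?D \<Otimes>\<^sub>M ?M) (count_space UNIV)"
    by measurable
  moreover have "prob_space ?D"
    by (rule prob_space.prob_space_distr[OF prob_space_measure_pmf rademacher_measurable])
  ultimately show ?thesis
    using comp by (auto simp: valid_alg_def sketch_tester_def sketch_column_def case_prod_unfold)
qed

lemma run_sketch_tester_iff:
  "run (sketch_tester d k) A \<omega> \<longleftrightarrow> (\<forall>z::int list. 0 \<le> (\<Sum>j<k. \<Sum>l<k.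
    real_of_int (z ! j) * real_of_int (z ! l) * answers (sketch_tester d k) A \<omega> (j * k + l)))"
proof -
  have "decide (sketch_tester d k) = (\<lambda>\<omega> a. \<forall>z::int list.
      0 \<le> (\<Sum>j<k. \<Sum>l<k. real_of_int (z ! j) * real_of_int (z ! l) * a (j * k + l)))"
    by (simp add: sketch_tester_def)
  thus ?thesis by (simp add: run_def)
qed

text \<open>Query number j * k + l is entry (j, l) of G^T A G, stored row by row.\<close>

lemma answers_sketch_tester:
  assumes "j < k" "l < k"
  shows "answers (sketch_tester d k) A \<omega> (j * k + l) =
    sketch_column d j \<omega> \<bullet> (A *\<^sub>v sketch_column d l \<omega>)"
proof -
  have "j * k + l < Suc j * k" using assms by simp
  also have "\<dots> \<le> k * k" using assms by (intro mult_right_mono) auto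
  finally show ?thesis using assms by (simp add: answers_def sketch_tester_def)
qed

lemma scalar_prod_mult_mat_vec:
  assumes "A \<in> carrier_mat d d"
  shows "vec d x \<bullet> (A *\<^sub>v vec d y) = (\<Sum>a<d. \<Sum>b<d. x a * A $$ (a, b) * y b)"
  using assms
  by (auto simp: scalar_prod_def lessThan_atLeast0 sum_distrib_left mult.assoc intro!: sum.cong)

text \<open>The identity x^T (G^T A G) x = (Gx)^T A (Gx). It holds for arbitrary real coins, not
  just signs, as one-sidedness on the whole coin space requires.\<close>

lemma sketched_quadratic_form:
  fixes x :: "nat \<Rightarrow> real" and k :: nat
  assumes A: "A \<in> carrier_mat d d"
  defines "y \<equiv> \<lambda>\<omega> a. \<Sum>j<k. x j * \<omega> (j * d + a)"
  shows "(\<Sum>j<k. \<Sum>l<k. x j * x l * answers (sketch_tester d k) A \<omega> (j * k + l)) =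
    vec d (y \<omega>) \<bullet> (A *\<^sub>v vec d (y \<omega>))"
proof -
  have "(\<Sum>j<k. \<Sum>l<k. x j * x l * answers (sketch_tester d k) A \<omega> (j * k + l)) =
    (\<Sum>j<k. \<Sum>l<k. \<Sum>a<d. \<Sum>b<d. (x j * \<omega> (j * d + a)) * A $$ (a, b) * (x l * \<omega> (l * d + b)))"
    by (intro sum.cong refl)
      (simp add: answers_sketch_tester sketch_column_def scalar_prod_mult_mat_vec[OF A]
        sum_distrib_left mult_ac)
  also have "\<dots> = (\<Sum>a<d. \<Sum>b<d. \<Sum>j<k. \<Sum>l<k.
      (x j * \<omega> (j * d + a)) * A $$ (a, b) * (x l * \<omega> (l * d + b)))"
    by (simp only: sum.swap[of _ "{..<d}" "{..<k}"])
  also have "\<dots> = (\<Sum>a<d. \<Sum>b<d. y \<omega> a * A $$ (a, b) * y \<omega> b)"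
    unfolding y_def by (simp add: sum_distrib_left sum_distrib_right mult_ac)
  finally show ?thesis by (simp add: scalar_prod_mult_mat_vec[OF A])
qed

text \<open>Nonnegativity carries over at every coefficient vector, so it does not matter which
  integers \<open>z ! j\<close> denotes beyond the length of z.\<close>

lemma one_sided_sketch_tester: "one_sided d (sketch_tester d k)"
  unfolding one_sided_def
proof (intro allI impI ballI)
  fix A \<omega> assume A: "psd d A"
  hence AC: "A \<in> carrier_mat d d" by (auto simp: psd_def symmetric_mat_def)
  show "run (sketch_tester d k) A \<omega>"
    using A sketched_quadratic_form[OF AC, where k = k and \<omega> = \<omega>]
    by (simp add: run_sketch_tester_iff psd_def)
qed

text \<open>Rounding x down to multiples of 1 / (n + 1) converges to x, so by continuity the form is
  negative at such a rational vector; clearing denominators multiplies it by the positive factor (n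
  + 1)^2.\<close>

lemma negative_form_at_integers:
  fixes B :: "nat \<Rightarrow> nat \<Rightarrow> real" and x :: "nat \<Rightarrow> real"
  assumes neg: "(\<Sum>j<k. \<Sum>l<k. x j * x l * B j l) < 0"
  shows "\<exists>z::int list. (\<Sum>j<k. \<Sum>l<k. real_of_int (z ! j) * real_of_int (z ! l) * B j l) < 0"
proof -
  define q where "q = (\<lambda>n j. real_of_int \<lfloor>real (Suc n) * x j\<rfloor> / real (Suc n))"
  have q: "(\<lambda>n. q n j) \<longlonglongrightarrow> x j" for j
  proof (rule LIMSEQ_I)
    fix e :: real assume "e > 0"
    then obtain n0 where n0: "inverse (real (Suc n0)) < e" using reals_Archimedean by blast
    have "norm (q n j - x j) < e" if "n \<ge> n0" for n
    proof -
      have "\<bar>real_of_int \<lfloor>r * x j\<rfloor> / r - x j\<bar> \<le> inverse r" if "r > 0" for r :: real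
      proof -
        have "\<bar>real_of_int \<lfloor>r * x j\<rfloor> - r * x j\<bar> / r \<le> 1 / r"
          using that by (intro divide_right_mono) linarith+
        moreover have "real_of_int \<lfloor>r * x j\<rfloor> / r - x j = (real_of_int \<lfloor>r * x j\<rfloor> - r * x j) / r"
          using that by (simp add: field_simps)
        ultimately show ?thesis using that by (simp add: inverse_eq_divide)
      qed
      hence "\<bar>q n j - x j\<bar> \<le> inverse (real (Suc n))"
        unfolding q_def by (simp del: of_nat_Suc)
      moreover have "inverse (real (Suc n)) \<le> inverse (real (Suc n0))" using that by simp
      ultimately show ?thesis using n0 unfolding real_norm_def by linarith
    qed
    thus "\<exists>no. \<forall>n\<ge>no. norm (q n j - x j) < e" by blast
  qed
  have "(\<lambda>n. \<Sum>j<k. \<Sum>l<k. q n j * q n l * B j l) \<longlonglongrightarrow> (\<Sum>j<k. \<Sum>l<k. x j * x l * B j l)"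
    by (intro tendsto_intros q)
  from order_tendstoD(2)[OF this neg] obtain n where
    n: "(\<Sum>j<k. \<Sum>l<k. q n j * q n l * B j l) < 0"
    by (auto simp: eventually_sequentially)
  define z where "z = map (\<lambda>j. \<lfloor>real (Suc n) * x j\<rfloor>) [0..<k]"
  have z: "real_of_int (z ! j) = real (Suc n) * q n j" if "j < k" for j
    using that by (simp add: z_def q_def)
  have "(\<Sum>j<k. \<Sum>l<k. real_of_int (z ! j) * real_of_int (z ! l) * B j l) =
      (real (Suc n))\<^sup>2 * (\<Sum>j<k. \<Sum>l<k. q n j * q n l * B j l)"
    by (simp add: z sum_distrib_left power2_eq_square mult_ac del: of_nat_Suc)
  also have "\<dots> < 0" using n by (simp add: mult_pos_neg)
  finally show ?thesis by blast
qed

lemma run_sketch_tester_False: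
  assumes A: "A \<in> carrier_mat d d"
    and neg: "vec d (\<lambda>a. \<Sum>j<k. x j * \<omega> (j * d + a)) \<bullet>
      (A *\<^sub>v vec d (\<lambda>a. \<Sum>j<k. x j * \<omega> (j * d + a))) < 0"
  shows "\<not> run (sketch_tester d k) A \<omega>"
proof -
  obtain z :: "int list" where "(\<Sum>j<k. \<Sum>l<k. real_of_int (z ! j) * real_of_int (z ! l) *
      answers (sketch_tester d k) A \<omega> (j * k + l)) < 0"
    using negative_form_at_integers[of x "\<lambda>j l. answers (sketch_tester d k) A \<omega> (j * k + l)" k]
      neg sketched_quadratic_form[OF A, of x k \<omega>] by auto
  thus ?thesis by (auto simp: run_sketch_tester_iff not_le)
qed


section \<open>Rejection of far matrices\<close>

lemma eigen_expansion_quadratic_form: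
  fixes y :: "nat \<Rightarrow> real"
  assumes "\<And>a b. a < d \<Longrightarrow> b < d \<Longrightarrow> A $$ (a, b) = (\<Sum>m<d. f m * v m a * v m b)"
  shows "(\<Sum>a<d. \<Sum>b<d. y a * A $$ (a, b) * y b) = (\<Sum>m<d. f m * (\<Sum>a<d. v m a * y a)\<^sup>2)"
proof -
  have "(\<Sum>a<d. \<Sum>b<d. y a * A $$ (a, b) * y b) =
      (\<Sum>a<d. \<Sum>b<d. \<Sum>m<d. f m * ((v m a * y a) * (v m b * y b)))"
    by (intro sum.cong refl) (simp add: assms sum_distrib_left sum_distrib_right mult_ac)
  also have "\<dots> = (\<Sum>a<d. \<Sum>m<d. \<Sum>b<d. f m * ((v m a * y a) * (v m b * y b)))"
    by (rule sum.cong[OF refl], rule sum.swap)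
  also have "\<dots> = (\<Sum>m<d. \<Sum>a<d. \<Sum>b<d. f m * ((v m a * y a) * (v m b * y b)))"
    by (rule sum.swap)
  also have "\<dots> = (\<Sum>m<d. f m * (\<Sum>a<d. v m a * y a)\<^sup>2)"
    unfolding power2_eq_square sum_product by (simp only: sum_distrib_left)
  finally show ?thesis .
qed

text \<open>Both parts of the weighted sum are nonnegative, so each is below 1. The part of i gives
  |T i - K| < K / 2, hence (T i)^2 > K^2 / 4; the other part bounds the remaining terms by 12 K M.
  The gap hypothesis says that the former outweighs the latter.\<close>

lemma eigenvalue_sum_neg:
  fixes f T :: "nat \<Rightarrow> real"
  assumes i: "i < d" "f i < 0" and K: "K > 0" and M: "M > 0" and k: "12 * K * M \<le> - f i * K\<^sup>2 / 4"
    and W: "(\<Sum>m<d. (if m = i then 4 / K\<^sup>2 else \<bar>f m\<bar> / (12 * K * M)) * (T m - K * of_bool (m = i))\<^sup>2) < 1"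
  shows "(\<Sum>m<d. f m * (T m)\<^sup>2) < 0"
proof -
  let ?J = "{..<d} - {i}"
  have split: "(\<Sum>m<d. g m) = g i + (\<Sum>m\<in>?J. g m)" for g :: "nat \<Rightarrow> real"
    using i by (simp add: sum.remove)
  have "(\<Sum>m<d. (if m = i then 4 / K\<^sup>2 else \<bar>f m\<bar> / (12 * K * M)) * (T m - K * of_bool (m = i))\<^sup>2) =
      4 / K\<^sup>2 * (T i - K)\<^sup>2 + (\<Sum>m\<in>?J. \<bar>f m\<bar> / (12 * K * M) * (T m)\<^sup>2)"
    unfolding split by (auto intro!: arg_cong2[where f = "(+)"] sum.cong)
  also have "(\<Sum>m\<in>?J. \<bar>f m\<bar> / (12 * K * M) * (T m)\<^sup>2) =
      (\<Sum>m\<in>?J. \<bar>f m\<bar> * (T m)\<^sup>2) / (12 * K * M)"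
    by (simp add: sum_divide_distrib)
  finally have W': "4 / K\<^sup>2 * (T i - K)\<^sup>2 + (\<Sum>m\<in>?J. \<bar>f m\<bar> * (T m)\<^sup>2) / (12 * K * M) < 1"
    using W by simp
  have nonneg: "(\<Sum>m\<in>?J. \<bar>f m\<bar> * (T m)\<^sup>2) \<ge> 0" by (intro sum_nonneg) auto
  have "(\<Sum>m\<in>?J. \<bar>f m\<bar> * (T m)\<^sup>2) / (12 * K * M) \<ge> 0"
    using nonneg K M by (intro divide_nonneg_pos) auto
  hence "4 / K\<^sup>2 * (T i - K)\<^sup>2 < 1" using W' by linarith
  hence "(T i - K)\<^sup>2 < (K / 2)\<^sup>2" using K by (simp add: field_simps power2_eq_square)
  hence "\<bar>T i - K\<bar> < K / 2" using K power_less_imp_less_base[of "\<bar>T i - K\<bar>" 2 "K / 2"] by simp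
  hence "T i > K / 2" by linarith
  hence T: "(T i)\<^sup>2 > K\<^sup>2 / 4"
    using K power_strict_mono[of "K / 2" "T i" 2] by (simp add: power_divide)
  have "4 / K\<^sup>2 * (T i - K)\<^sup>2 \<ge> 0" by simp
  hence "(\<Sum>m\<in>?J. \<bar>f m\<bar> * (T m)\<^sup>2) / (12 * K * M) < 1" using W' by linarith
  hence R: "(\<Sum>m\<in>?J. \<bar>f m\<bar> * (T m)\<^sup>2) < 12 * K * M" using K M by (simp add: field_simps)
  have "(\<Sum>m<d. f m * (T m)\<^sup>2) \<le> f i * (T i)\<^sup>2 + (\<Sum>m\<in>?J. \<bar>f m\<bar> * (T m)\<^sup>2)"
    unfolding split by (intro add_left_mono sum_mono mult_right_mono) auto
  also have "\<dots> < f i * (K\<^sup>2 / 4) + 12 * K * M"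
    using R mult_strict_left_mono_neg[OF T i(2)] by linarith
  also have "\<dots> \<le> 0" using k by (simp add: field_simps)
  finally show ?thesis .
qed

lemma prob_sketch_tester_False:
  assumes A: "symmetric_mat d A" and ne: "A \<noteq> 0\<^sub>m d d" and d: "d \<ge> 1" and p: "1 \<le> p"
    and eps: "0 < \<epsilon>" and far: "lambda_min A \<le> - \<epsilon> * schatten_norm p A"
    and k: "48 * (real d powr (1 - 1 / real_of_ereal p) / \<epsilon>) \<le> real k" "48 \<le> k"
  shows "prob_output (sketch_tester d k) A False \<ge> 2 / 3"
proof -
  obtain f v where eigen: "(\<forall>i<d. \<forall>j<d. (\<Sum>a<d. v i a * v j a) = of_bool (i = j)) \<and>
      (\<forall>a<d. \<forall>b<d. A $$ (a, b) = (\<Sum>m<d. f m * v m a * v m b)) \<and>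
      spectrum A = f ` {..<d} \<and>
      singular_values A = image_mset (\<lambda>i. \<bar>f i\<bar>) (mset_set {..<d})"
    using symmetric_mat_eigen_expansion[OF A] by (elim exE)
  have orth: "(\<Sum>a<d. v i a * v j a) = of_bool (i = j)" if "i < d" "j < d" for i j
    using eigen that by blast
  have exp: "A $$ (a, b) = (\<Sum>m<d. f m * v m a * v m b)" if "a < d" "b < d" for a b
    using eigen that by blast
  have spec: "spectrum A = f ` {..<d}"
    and sv: "singular_values A = image_mset (\<lambda>i. \<bar>f i\<bar>) (mset_set {..<d})"
    using eigen by blast+
  note AC = symmetric_matD(1)[OF A]
  have "lambda_min A \<in> spectrum A"
    unfolding lambda_min_def spec by (rule Min_in) (use d in \<open>auto simp: lessThan_empty_iff\<close>)
  then obtain i where i: "i < d" "f i = lambda_min A" by (auto simp: spec)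
  define M where "M = (\<Sum>m<d. \<bar>f m\<bar>)"
  define c where "c = real d powr (1 - 1 / real_of_ereal p)"
  define K where "K = real k"
  have c: "c > 0" using d by (simp add: c_def)
  have K: "K > 0" "K \<ge> 48" using k(2) by (simp_all add: K_def)
  have M: "M > 0"
  proof (rule ccontr)
    assume "\<not> M > 0"
    hence "M = 0" by (simp add: M_def sum_nonneg antisym not_less)
    hence "f m = 0" if "m < d" for m using that by (simp add: M_def sum_nonneg_eq_0_iff)
    hence "A = 0\<^sub>m d d" using AC by (intro eq_matI) (auto simp: exp)
    thus False using ne by simp
  qed
  \<comment> \<open>Distance relative to the Schatten-p norm becomes distance relative to the trace
    norm M, at the price of the factor c.\<close>
  have "M \<le> c * schatten_norm p A"
    unfolding M_def c_def by (rule sum_le_schatten_norm[OF d p sv])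
  hence "\<epsilon> * M / c \<le> \<epsilon> * schatten_norm p A" using c eps by (simp add: field_simps)
  hence fi: "f i \<le> - (\<epsilon> * M / c)" using far i(2) by simp
  have fi_neg: "f i < 0"
  proof -
    have "\<epsilon> * M / c > 0" using c eps M by simp
    thus ?thesis using fi by linarith
  qed
  have kc: "48 * (c / \<epsilon>) \<le> K" using k(1) by (simp add: c_def K_def)
  \<comment> \<open>The 48 in the size of k is 12 * 4: 12 from the weight of the other eigenvalues,
    4 from the bound K^2 / 4 on (T i)^2.\<close>
  have "12 * K * M = (48 * (c / \<epsilon>)) * (\<epsilon> * M / c) * K / 4"
    using c eps by (simp add: field_simps)
  also have "\<dots> \<le> K * (- f i) * K / 4"
    using kc fi c eps M K by (intro divide_right_mono mult_right_mono mult_mono) auto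
  also have "\<dots> = - f i * K\<^sup>2 / 4" by (simp add: power2_eq_square)
  finally have gap: "12 * K * M \<le> - f i * K\<^sup>2 / 4" .

  define g where "g = (\<lambda>S j a. rademacher S (j * d + a))"
  \<comment> \<open>\<open>T m S\<close> is v_m^T G G^T v_i, the component of G G^T v_i along
    v_m.\<close>
  define T where "T = (\<lambda>m S. \<Sum>j<k. (\<Sum>a<d. v i a * g S j a) * (\<Sum>a<d. v m a * g S j a))"
  \<comment> \<open>The weighted sum \<open>W\<close> covers both bad events, \<open>T i\<close> far below \<open>K\<close> and a large contribution of the
    other eigenvalues, so that one application of Markov's inequality suffices.\<close>
  define coef where "coef = (\<lambda>m. if m = i then 4 / K\<^sup>2 else \<bar>f m\<bar> / (12 * K * M))"
  define W where "W = (\<lambda>S. \<Sum>m<d. coef m * (T m S - K * of_bool (m = i))\<^sup>2)"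
  define P where "P = pmf_of_set (Pow {..<k * d})"
  have fin: "finite (set_pmf P)" unfolding P_def by (subst set_pmf_of_set) auto
  have int [simp]: "integrable (measure_pmf P) h" for h :: "nat set \<Rightarrow> real"
    by (rule integrable_measure_pmf_finite[OF fin])
  have coef: "coef m \<ge> 0" for m using K M by (simp add: coef_def)

  have reject: "\<not> run (sketch_tester d k) A (rademacher S)" if "W S < 1" for S
  proof -
    \<comment> \<open>The witness x = G^T v_i with y = Gx. It depends on the unknown A, but
      rejection needs only that some negative direction of the sketch exists.\<close>
    define x where "x = (\<lambda>j. \<Sum>a<d. v i a * g S j a)"
    define y where "y = (\<lambda>a. \<Sum>j<k. x j * rademacher S (j * d + a))"
    have T: "T m S = (\<Sum>a<d. v m a * y a)" for m
    proof -
      have "T m S = (\<Sum>j<k. x j * (\<Sum>a<d. v m a * rademacher S (j * d + a)))"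
        by (simp add: T_def x_def g_def)
      also have "\<dots> = (\<Sum>a<d. v m a * y a)"
        unfolding y_def sum_distrib_left by (subst sum.swap) (simp only: mult.left_commute)
      finally show ?thesis .
    qed
    have "vec d y \<bullet> (A *\<^sub>v vec d y) = (\<Sum>m<d. f m * (T m S)\<^sup>2)"
      unfolding scalar_prod_mult_mat_vec[OF AC] T by (rule eigen_expansion_quadratic_form) (rule exp)
    also have "\<dots> < 0"
      by (rule eigenvalue_sum_neg[where i = i and f = f, OF i(1) fi_neg K(1) M gap])
        (use that in \<open>simp add: W_def coef_def\<close>)
    finally show ?thesis
      unfolding y_def by (rule run_sketch_tester_False[OF AC])
  qed

  have var: "measure_pmf.expectation P (\<lambda>S. (T m S - K * of_bool (m = i))\<^sup>2) \<le> 2 * K" if m: "m < d" for m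
  proof -
    have unit: "(\<Sum>a<d. (v i a)\<^sup>2) = 1" "(\<Sum>a<d. (v m a)\<^sup>2) = 1"
      using orth[OF i(1) i(1)] orth[OF m m] by (simp_all add: power2_eq_square)
    have dot: "(\<Sum>a<d. v i a * v m a) = of_bool (m = i)"
      using orth[OF i(1) m] by auto
    show ?thesis
      using rademacher_bilinear_variance[OF unit, of k] unfolding T_def g_def P_def K_def dot .
  qed
  have "measure_pmf.expectation P W \<le> (\<Sum>m<d. coef m * (2 * K))"
    unfolding W_def by (subst Bochner_Integration.integral_sum, simp)
      (use var coef in \<open>auto intro!: sum_mono mult_left_mono\<close>)
  \<comment> \<open>Each half of the failure budget 1/3 is 1/6: 8 / K because K \<ge> 48, and M / (6
    M) for the other eigenvalues.\<close>
  also have "\<dots> = 8 / K + (\<Sum>m\<in>{..<d} - {i}. \<bar>f m\<bar>) / (6 * M)"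
  proof -
    have "(\<Sum>m<d. coef m * (2 * K)) =
        coef i * (2 * K) + (\<Sum>m\<in>{..<d} - {i}. coef m * (2 * K))"
      using i by (simp add: sum.remove)
    also have "(\<Sum>m\<in>{..<d} - {i}. coef m * (2 * K)) = (\<Sum>m\<in>{..<d} - {i}. \<bar>f m\<bar> / (6 * M))"
      using K by (intro sum.cong refl) (auto simp: coef_def field_simps)
    finally show ?thesis using K by (simp add: coef_def sum_divide_distrib power2_eq_square)
  qed
  also have "(\<Sum>m\<in>{..<d} - {i}. \<bar>f m\<bar>) \<le> M" unfolding M_def by (rule sum_mono2) auto
  also have "8 / K + M / (6 * M) \<le> 1 / 3" using K M by (simp add: field_simps)
  finally have EW: "measure_pmf.expectation P W \<le> 1 / 3"
    using M by (simp add: divide_right_mono)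

  have "measure_pmf.prob P {S. W S \<ge> 1} \<le> 1 / 3"
  proof -
    have "measure_pmf.prob P {S \<in> space (measure_pmf P). W S \<ge> 1} \<le> measure_pmf.expectation P W / 1"
      by (rule integral_Markov_inequality_measure[where A = "{}"])
        (auto simp: W_def coef intro!: sum_nonneg)
    thus ?thesis using EW by simp
  qed
  moreover have "measure_pmf.prob P {S. W S < 1} = 1 - measure_pmf.prob P {S. W S \<ge> 1}"
    using measure_pmf.prob_compl[of "{S. W S \<ge> 1}" P] by (simp add: Compl_eq not_le flip: Compl_eq_Diff_UNIV)
  ultimately have "2 / 3 \<le> measure_pmf.prob P {S. W S < 1}" by linarith
  also have "\<dots> \<le> measure_pmf.prob P {S. \<not> run (sketch_tester d k) A (rademacher S)}"
    by (rule measure_pmf.finite_measure_mono) (use reject in auto)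
  also have "\<dots> = prob_output (sketch_tester d k) A False"
  proof -
    have coins: "coin_dist (sketch_tester d k) = distr (measure_pmf P) (\<Pi>\<^sub>M i\<in>UNIV. borel) rademacher"
      by (simp add: sketch_tester_def P_def)
    have "{\<omega> \<in> space (coin_dist (sketch_tester d k)). run (sketch_tester d k) A \<omega> = False} \<in>
        sets (coin_dist (sketch_tester d k))"
      using measurable_sets[OF run_measurable[OF valid_alg_sketch_tester AC], of "{False}"]
      by (simp add: vimage_def Int_def conj_commute)
    thus ?thesis
      unfolding prob_output_def coins
      by (subst measure_distr[OF rademacher_measurable])
        (auto intro!: arg_cong[where f = "measure _"] simp: space_PiM)
  qed
  finally show ?thesis .
qed

theorem corollary42:
  shows "\<exists>C::real. C > 0 \<and>
    (\<forall>(d::nat) (p::ereal) (\<epsilon>::real). d \<ge> 1 \<longrightarrow> 1 \<le> p \<longrightarrow> 0 < \<epsilon> \<longrightarrow> \<epsilon> < 1 \<longrightarrow>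
      (\<exists>T. psd_tester d \<epsilon> p T \<and> one_sided d T \<and>
           makes_at_most T (C * (1 / \<epsilon>\<^sup>2) * real d powr real_of_ereal (2 - 2 / p))))"
\<comment> \<open>2401 is 49^2: rounding 48 s up to the integer k costs less than 1, and 1 \<le> s,
  so k \<le> 49 s, and k^2 queries are made.\<close>
proof (intro exI[of _ "2401 :: real"] conjI allI impI)
  fix d :: nat and p :: ereal and \<epsilon> :: real
  assume d: "d \<ge> 1" and p: "1 \<le> p" and eps: "0 < \<epsilon>" "\<epsilon> < 1"
  define t where "t = 1 - 1 / real_of_ereal p"
  define s where "s = real d powr t / \<epsilon>"
  define k where "k = nat \<lceil>48 * s\<rceil>"
  \<comment> \<open>For infinite p the term \<open>1 / real_of_ereal p\<close> is 0, so t = 1, which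
    agrees with the exponent 2 of the query bound.\<close>
  have t: "t \<ge> 0" "real_of_ereal (2 - 2 / p) = 2 * t"
  proof -
    show "t \<ge> 0" using p by (cases p) (auto simp: t_def)
    show "real_of_ereal (2 - 2 / p) = 2 * t"
    proof (cases p)
      case (real r)
      thus ?thesis using p by (simp add: t_def numeral_eq_ereal)
    qed (use p in \<open>auto simp: t_def\<close>)
  qed
  have "1 \<le> real d powr t" using d t by (simp add: ge_one_powr_ge_zero)
  hence s: "s \<ge> 1" using eps by (simp add: s_def field_simps)
  have k: "48 * s \<le> real k" "real k \<le> 49 * s"
    using s by (simp_all add: k_def) linarith+
  have k48: "48 \<le> k" using k(1) s by linarith
  let ?T = "sketch_tester d k"
  have one: "one_sided d ?T" by (rule one_sided_sketch_tester)
  have valid: "valid_alg d ?T" by (rule valid_alg_sketch_tester)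
  have "psd_tester d \<epsilon> p ?T"
    unfolding psd_tester_def
  proof (intro conjI allI impI valid)
    fix A assume "psd d A"
    hence "{\<omega> \<in> space (coin_dist ?T). run ?T A \<omega> = True} = space (coin_dist ?T)"
      using one by (auto simp: one_sided_def)
    moreover have "prob_space (coin_dist ?T)" using valid by (simp add: valid_alg_def)
    ultimately show "2 / 3 \<le> prob_output ?T A True"
      by (simp add: prob_output_def prob_space.prob_space)
  next
    fix A assume "symmetric_mat d A" "A \<noteq> 0\<^sub>m d d \<and> lambda_min A \<le> - \<epsilon> * schatten_norm p A"
    thus "2 / 3 \<le> prob_output ?T A False"
      using prob_sketch_tester_False[OF _ _ d p eps(1)] k(1) k48 by (simp add: s_def t_def)
  qed
  moreover have "makes_at_most ?T (2401 * (1 / \<epsilon>\<^sup>2) * real d powr real_of_ereal (2 - 2 / p))"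
  proof -
    have "real (k * k) \<le> (49 * s) * (49 * s)"
      unfolding of_nat_mult using k s by (intro mult_mono) auto
    also have "\<dots> = 2401 * (1 / \<epsilon>\<^sup>2) * real d powr real_of_ereal (2 - 2 / p)"
      using eps unfolding t(2) by (simp add: s_def power2_eq_square powr_add[symmetric] field_simps)
    finally show ?thesis by (simp add: makes_at_most_def sketch_tester_def)
  qed
  ultimately show "\<exists>T. psd_tester d \<epsilon> p T \<and> one_sided d T \<and>
      makes_at_most T (2401 * (1 / \<epsilon>\<^sup>2) * real d powr real_of_ereal (2 - 2 / p))"
    using one by blast
qed simp

end
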